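(* Let $\mathcal{G}$ be a finite connected graph with $n \ge 2$ vertices, with discrete gradient $\nabla$ and graph Laplacian $\Delta = \nabla^T\nabla$. Let $0=\omega_1^2 < \omega_2^2 \le \dots \le \omega_n^2$ be the eigenvalues of $\Delta$ and $\mathbf{v}^1,\dots,\mathbf{v}^n$ a corresponding orthonormal basis of eigenvectors. Let $P \in \mathbb{R}^n$ satisfy $\sum_{k=1}^n P_k = 0$, and write $P = \sum_{i=1}^n p_i \mathbf{v}^i$. Then $p_1 = 0$, the vector $$\theta = -\sum_{i=2}^n \frac{p_i}{\omega_i^2}\,\mathbf{v}^i$$ is a solution of the singular linear system $-\Delta\theta = P$, and the corresponding line power vector $P_l = \nabla\theta$ is $$P_l = -\sum_{i=2}^n \frac{p_i}{\omega_i^2}\,\nabla \mathbf{v}^i .$$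
   Context: The graph is simple and undirected with all lines (edges) identical (unit weights); $P_k$ denotes the component of $P$ at vertex $k$ in the canonical basis. Fix an arbitrary orientation of the edges. The discrete gradient $\nabla$ is the matrix with one row per edge and one column per vertex (the transpose of the oriented incidence matrix), with entries in $\{0,\pm 1\}$: the row of an edge with end vertices $a$ and $b$ has one entry $+1$ and one entry $-1$ in columns $a$ and $b$, according to the orientation, and zeros elsewhere. The graph Laplacian is $\Delta = \nabla^T\nabla$, i.e. $\Delta_{ii}$ is the degree of vertex $i$ and, for $i\ne j$, $\Delta_{ij}=-1$ if $i$ and $j$ are adjacent and $0$ otherwise. *)

theory Defs
  imports "HOL-Analysis.Analysis"
begin

text \<open>The vertex set of a graph is the whole finite type \<open>'v\<close>, so that vectors over the vertices
  live in \<open>real ^ 'v\<close>; a graph is given by its set of edges, each a two-element set of vertices.\<close>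

definition simple_graph :: "'v set set \<Rightarrow> bool" where
  "simple_graph E \<longleftrightarrow> (\<forall>e\<in>E. card e = 2)"

definition adjacent :: "'v set set \<Rightarrow> 'v \<Rightarrow> 'v \<Rightarrow> bool" where
  "adjacent E a b \<longleftrightarrow> {a, b} \<in> E"

definition degree :: "'v set set \<Rightarrow> 'v \<Rightarrow> nat" where
  "degree E a = card {e \<in> E. a \<in> e}"

definition connected_graph :: "'v set set \<Rightarrow> bool" where
  "connected_graph E \<longleftrightarrow> (\<forall>a b. (adjacent E)\<^sup>*\<^sup>* a b)"

text \<open>The type \<open>'e\<close> labels the edges (and hence the rows of the gradient) bijectively; the edge
  with label \<open>l\<close> is oriented from \<open>src l\<close> to \<open>tgt l\<close>.\<close>

definition orientation :: "'v set set \<Rightarrow> ('e \<Rightarrow> 'v) \<Rightarrow> ('e \<Rightarrow> 'v) \<Rightarrow> bool" where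
  "orientation E src tgt \<longleftrightarrow> bij_betw (\<lambda>l. {src l, tgt l}) UNIV E"

definition gradient :: "('e \<Rightarrow> 'v) \<Rightarrow> ('e \<Rightarrow> 'v) \<Rightarrow> real ^ 'v ^ 'e" where
  "gradient src tgt = (\<chi> l k. if k = tgt l then 1 else if k = src l then - 1 else 0)"

definition laplacian :: "('e::finite \<Rightarrow> 'v) \<Rightarrow> ('e \<Rightarrow> 'v) \<Rightarrow> real ^ 'v ^ 'v" where
  "laplacian src tgt = transpose (gradient src tgt) ** gradient src tgt"

lemma laplacian_entries:
  fixes E :: "'v::finite set set" and src tgt :: "'e::finite \<Rightarrow> 'v"
  assumes "simple_graph E" and "orientation E src tgt"
  shows "laplacian src tgt $ i $ j =
    (if i = j then real (degree E i) else if adjacent E i j then - 1 else 0)"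
proof -
  let ?f = "\<lambda>l. {src l, tgt l}"
  have bij: "bij_betw ?f UNIV E" using assms(2) by (simp add: orientation_def)
  have ne: "src l \<noteq> tgt l" for l
  proof
    assume "src l = tgt l"
    moreover have "?f l \<in> E" using bij by (auto simp: bij_betw_def)
    then have "card (?f l) = 2" using assms(1) unfolding simple_graph_def by blast
    ultimately show False by simp
  qed
  define g where "g = (\<lambda>e. if i = j then (if i \<in> e then 1 else 0)
    else if e = {i, j} then - 1 else (0::real))"
  have "laplacian src tgt $ i $ j = (\<Sum>l\<in>UNIV. g (?f l))"
    unfolding laplacian_def matrix_matrix_mult_def transpose_def gradient_def g_def
    using ne by (auto intro!: sum.cong simp: doubleton_eq_iff)
  also have "\<dots> = sum g E" using sum.reindex_bij_betw[OF bij, of g] by simp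
  also have "\<dots> = (if i = j then real (degree E i) else if adjacent E i j then - 1 else 0)"
    unfolding g_def degree_def adjacent_def
    by (auto simp: sum.If_cases Int_def)
  finally show ?thesis .
qed

definition orthonormal_basis :: "'i set \<Rightarrow> ('i \<Rightarrow> 'a::euclidean_space) \<Rightarrow> bool" where
  "orthonormal_basis I v \<longleftrightarrow>
     (\<forall>i\<in>I. \<forall>j\<in>I. v i \<bullet> v j = (if i = j then 1 else 0)) \<and> span (v ` I) = UNIV"

end

theory Submission
  imports Defs
begin

text \<open>The quadratic form of the Laplacian is \<open>x \<bullet> \<Delta> x = \<parallel>\<nabla> x\<parallel>\<^sup>2\<close>, so on a connected graph
  its kernel consists of the constant vectors. Hence the eigenvalue \<open>0\<close> occurs, is simple, and
  belongs to a constant eigenvector; \<open>p 1\<close> is a multiple of the sum of the entries of \<open>P\<close>.\<close>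

lemma orientation_endpoints_distinct:
  assumes "simple_graph E" and "orientation E src tgt"
  shows "src l \<noteq> tgt l"
proof
  assume "src l = tgt l"
  moreover have "{src l, tgt l} \<in> E"
    using assms(2) by (auto simp: orientation_def bij_betw_def)
  then have "card {src l, tgt l} = 2"
    using assms(1) unfolding simple_graph_def by blast
  ultimately show False by simp
qed

lemma gradient_mult_component:
  fixes src tgt :: "'e::finite \<Rightarrow> 'v::finite"
  assumes "simple_graph E" and "orientation E src tgt"
  shows "(gradient src tgt *v x) $ l = x $ tgt l - x $ src l"
proof -
  \<comment> \<open>The nested conditional splits into a difference of two because
    \<open>tgt l\<close> and \<open>src l\<close> differ.\<close>
  have "(gradient src tgt *v x) $ l
      = (\<Sum>k\<in>UNIV. (if k = tgt l then x $ k else 0) - (if k = src l then x $ k else 0))"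
    unfolding matrix_vector_mult_def gradient_def
    using orientation_endpoints_distinct[OF assms, of l] by (auto intro!: sum.cong)
  then show ?thesis by (simp add: sum_subtractf)
qed

text \<open>The transpose moves across the inner product. Taking \<open>y = x\<close> determines the
  kernel; taking \<open>y = 1\<close> makes the right side vanish.\<close>

lemma inner_laplacian:
  fixes src tgt :: "'e::finite \<Rightarrow> 'v::finite"
  shows "(laplacian src tgt *v x) \<bullet> y = (gradient src tgt *v x) \<bullet> (gradient src tgt *v y)"
  by (simp add: laplacian_def dot_lmul_matrix flip: matrix_vector_mul_assoc)

text \<open>A zero gradient equates the values at the two ends of each edge, and connectedness
  carries this along a path.\<close>

lemma gradient_zero_imp_constant:
  fixes E :: "'v::finite set set" and src tgt :: "'e::finite \<Rightarrow> 'v"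
  assumes "simple_graph E" and "connected_graph E" and "orientation E src tgt"
    and "gradient src tgt *v x = 0"
  shows "x $ a = x $ b"
proof -
  have step: "x $ a = x $ b" if "adjacent E a b" for a b
  proof -
    have "{a, b} \<in> range (\<lambda>l. {src l, tgt l})"
      using that assms(3) unfolding adjacent_def orientation_def bij_betw_def by simp
    then obtain l where "{a, b} = {src l, tgt l}" by (elim rangeE)
    moreover have "x $ tgt l = x $ src l"
      using gradient_mult_component[OF assms(1,3), of x l]
        assms(4) by simp
    ultimately show ?thesis by (auto simp: doubleton_eq_iff)
  qed
  have "(adjacent E)\<^sup>*\<^sup>* a b"
    using assms(2) by (simp add: connected_graph_def)
  then show ?thesis by induction (auto dest: step)
qed

lemma laplacian_zero_imp_constant:
  fixes E :: "'v::finite set set" and src tgt :: "'e::finite \<Rightarrow> 'v"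
  assumes "simple_graph E" and "connected_graph E" and "orientation E src tgt"
    and "laplacian src tgt *v x = 0"
  obtains c where "x = c *\<^sub>R 1"
proof
  have "gradient src tgt *v x = 0"
    using inner_laplacian[of src tgt x x] assms(4) by simp
  \<comment> \<open>Here \<open>undefined\<close> is merely an arbitrary reference vertex.\<close>
  then have "x $ k = x $ undefined" for k
    using gradient_zero_imp_constant[OF assms(1-3)] by blast
  then show "x = (x $ undefined) *\<^sub>R 1" by (simp add: vec_eq_iff)
qed

lemma inner_one_vec: "(1 :: real ^ 'n) \<bullet> x = (\<Sum>k\<in>UNIV. x $ k)"
  by (simp add: inner_vec_def)

text \<open>A vector orthogonal to a spanning set is orthogonal to itself, hence zero.\<close>

lemma orthonormal_basis_nonorthogonal:
  assumes "orthonormal_basis I v" and "x \<noteq> 0"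
  obtains i where "i \<in> I" and "v i \<bullet> x \<noteq> 0"
proof -
  have "\<exists>i\<in>I. v i \<bullet> x \<noteq> 0"
  proof (rule ccontr)
    assume "\<not> (\<exists>i\<in>I. v i \<bullet> x \<noteq> 0)"
    then have "orthogonal x y" if "y \<in> v ` I" for y
      using that by (auto simp: orthogonal_def inner_commute)
    moreover have "x \<in> span (v ` I)"
      using assms(1) by (simp add: orthonormal_basis_def)
    ultimately have "orthogonal x x" using orthogonal_to_span by blast
    with assms(2) show False by (simp add: orthogonal_def)
  qed
  then show thesis using that by blast
qed

theorem mainTheorem1:
  fixes E :: "'v::finite set set"
    and src tgt :: "'e::finite \<Rightarrow> 'v"
    and \<omega> :: "nat \<Rightarrow> real"
    and v :: "nat \<Rightarrow> real ^ 'v"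
    and p :: "nat \<Rightarrow> real"
    and P \<theta> :: "real ^ 'v"
    and P\<^sub>l :: "real ^ 'e"
  assumes "CARD('v) \<ge> 2"
    and "simple_graph E"
    and "connected_graph E"
    and "orientation E src tgt"
    and "orthonormal_basis {1..CARD('v)} v"
    and "\<And>i. i \<in> {1..CARD('v)} \<Longrightarrow> laplacian src tgt *v v i = (\<omega> i)\<^sup>2 *\<^sub>R v i"
    and "mono_on {1..CARD('v)} (\<lambda>i. (\<omega> i)\<^sup>2)"
    and "(\<Sum>k\<in>UNIV. P $ k) = 0"
    and "P = (\<Sum>i = 1..CARD('v). p i *\<^sub>R v i)"
    and "\<theta> = - (\<Sum>i = 2..CARD('v). (p i / (\<omega> i)\<^sup>2) *\<^sub>R v i)"
    and "P\<^sub>l = gradient src tgt *v \<theta>"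
  shows "(\<omega> 1)\<^sup>2 = 0 \<and> 0 < (\<omega> 2)\<^sup>2
    \<and> p 1 = 0
    \<and> (- laplacian src tgt) *v \<theta> = P
    \<and> P\<^sub>l = - (\<Sum>i = 2..CARD('v). (p i / (\<omega> i)\<^sup>2) *\<^sub>R (gradient src tgt *v v i))"
proof -
  let ?n = "CARD('v)" and ?L = "laplacian src tgt" and ?D = "gradient src tgt"
  note graph = assms(2-4)
  have dot: "v i \<bullet> v j = (if i = j then 1 else 0)" if "i \<in> {1..?n}" "j \<in> {1..?n}" for i j
    using assms(5) that unfolding orthonormal_basis_def by blast
  have in12: "1 \<in> {1..?n}" "2 \<in> {1..?n}" using assms(1) by auto
  have D1: "?D *v 1 = 0"
    using gradient_mult_component[OF graph(1,3), of 1]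
    by (simp add: vec_eq_iff)
  \<comment> \<open>Some eigenvector is not orthogonal to the constants. Its eigenvalue must be 0,
    and the ordering, with squares nonnegative, passes this down to index 1.\<close>
  obtain i where i: "i \<in> {1..?n}" "v i \<bullet> 1 \<noteq> 0"
    using orthonormal_basis_nonorthogonal[OF assms(5), of 1] by auto
  have "(\<omega> i)\<^sup>2 * (v i \<bullet> 1) = 0"
    using inner_laplacian[of src tgt "v i" 1] assms(6)[OF i(1)] D1 by simp
  moreover have "(\<omega> 1)\<^sup>2 \<le> (\<omega> i)\<^sup>2"
    using mono_onD[OF assms(7) in12(1) i(1)] i(1) by simp
  ultimately have w1: "(\<omega> 1)\<^sup>2 = 0" using i(2) by simp
  then have "?L *v v 1 = 0" using assms(6)[OF in12(1)] by simp
  then obtain c where c: "v 1 = c *\<^sub>R 1" by (rule laplacian_zero_imp_constant[OF graph])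
  have w2: "0 < (\<omega> 2)\<^sup>2"
  proof (rule ccontr)
    assume "\<not> 0 < (\<omega> 2)\<^sup>2"
    then have "?L *v v 2 = 0" using assms(6)[OF in12(2)] by simp
    then obtain d where d: "v 2 = d *\<^sub>R 1" by (rule laplacian_zero_imp_constant[OF graph])
    \<comment> \<open>Two multiples of the same vector cannot be orthonormal.\<close>
    have "v 1 \<bullet> v 1 = 1" "v 2 \<bullet> v 2 = 1" "v 1 \<bullet> v 2 = 0" using dot in12 by auto
    then show False using c d by auto
  qed
  \<comment> \<open>Orthonormality isolates the coefficient \<open>p 1\<close>; as
    \<open>v 1\<close> is constant, it is \<open>c\<close> times the entry sum of
    \<open>P\<close>.\<close>
  have "P \<bullet> v 1 = (\<Sum>i = 1..?n. if i = 1 then p i else 0)"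
    unfolding assms(9) inner_sum_left by (intro sum.cong) (auto simp: dot)
  then have "p 1 = P \<bullet> v 1" using in12(1) by simp
  also have "\<dots> = 0" unfolding c using assms(8) by (simp add: inner_commute[of P] inner_one_vec)
  finally have p1: "p 1 = 0" .
  have "(p i / (\<omega> i)\<^sup>2) *\<^sub>R (?L *v v i) = p i *\<^sub>R v i" if "i \<in> {2..?n}" for i
  proof -
    \<comment> \<open>The eigenvalue cancels only if nonzero, since division by 0 yields 0; the
      ordering bounds it below by the second one.\<close>
    have "(\<omega> 2)\<^sup>2 \<le> (\<omega> i)\<^sup>2" using mono_onD[OF assms(7) in12(2), of i] that by simp
    then have "(\<omega> i)\<^sup>2 \<noteq> 0" using w2 by linarith
    then show ?thesis using assms(6)[of i] that by simp
  qed
  then have "?L *v \<theta> = - (\<Sum>i = 2..?n. p i *\<^sub>R v i)"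
    by (simp add: assms(10) vec.neg vec.sum matrix_vector_mult_scaleR)
  \<comment> \<open>The missing term at index 1 vanishes because \<open>p 1 = 0\<close>.\<close>
  also have "(\<Sum>i = 2..?n. p i *\<^sub>R v i) = P"
    unfolding assms(9) using in12(1) p1
    by (intro sum.mono_neutral_left) (auto simp: Suc_le_eq le_eq_less_or_eq numeral_2_eq_2)
  finally have "(- ?L) *v \<theta> = P"
    by (metis add.inverse_inverse diff_0 matrix_vector_mult_0 matrix_vector_mult_diff_rdistrib)
  moreover have "P\<^sub>l = - (\<Sum>i = 2..?n. (p i / (\<omega> i)\<^sup>2) *\<^sub>R (?D *v v i))"
    by (simp add: assms(10,11) vec.neg vec.sum matrix_vector_mult_scaleR)
  ultimately show ?thesis using w1 w2 p1 by blast
qed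

end
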